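(* For every $\alpha\in[0,1]$ there exists a Dirichlet series $f(s)=\sum_{n=1}^\infty a_n n^{-s}$ with completely multiplicative coefficients $a_n\in\mathbb{C}$ such that $\sigma_a(f)-\sigma_c(f)=\alpha$.
   Context: An (ordinary) Dirichlet series is a series $f(s)=\sum_{n=1}^\infty a_n n^{-s}$ with complex coefficients $a_n$ and $s=\sigma+it$, where $\sigma,t\in\mathbb{R}$. Its coefficients are completely multiplicative if $a_{mn}=a_m a_n$ for all positive integers $m,n$. The abscissas of simple and absolute convergence are $$\sigma_c(f)=\inf\Big\{\sigma\in\mathbb{R} : \sum_{n=1}^\infty a_n n^{-\sigma}\text{ converges}\Big\},\qquad \sigma_a(f)=\inf\Big\{\sigma\in\mathbb{R} : \sum_{n=1}^\infty |a_n| n^{-\sigma}\text{ converges}\Big\}.$$ Writing that a difference of abscissas equals a real number $\alpha$ is understood to mean that both abscissas are finite. *)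

theory Defs
  imports "HOL-Analysis.Analysis"
begin

text \<open>
  A Dirichlet series is represented by its coefficient sequence \<open>a :: nat \<Rightarrow> complex\<close>.
  Only the values \<open>a n\<close> with \<open>n \<ge> 1\<close> matter: the series is \<open>a 1 * 1\<^sup>-\<^sup>s + a 2 * 2\<^sup>-\<^sup>s + \<dots>\<close>, so
  the summation index is shifted by \<open>Suc\<close> and \<open>a 0\<close> is never inspected.
\<close>

definition completely_multiplicative :: "(nat \<Rightarrow> complex) \<Rightarrow> bool" where
  "completely_multiplicative a \<longleftrightarrow> (\<forall>m\<ge>1. \<forall>n\<ge>1. a (m * n) = a m * a n)"

text \<open>
  The abscissas are infima in the extended reals, so that they are \<open>\<infinity>\<close> when the series converges
  for no real \<open>\<sigma>\<close> and \<open>-\<infinity>\<close> when the set of such \<open>\<sigma>\<close> is unbounded below.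
\<close>

definition abscissa_conv :: "(nat \<Rightarrow> complex) \<Rightarrow> ereal" where
  "abscissa_conv a =
     Inf (ereal ` {\<sigma>. summable (\<lambda>n. a (Suc n) * of_nat (Suc n) powr (- complex_of_real \<sigma>))})"

definition abscissa_abs_conv :: "(nat \<Rightarrow> complex) \<Rightarrow> ereal" where
  "abscissa_abs_conv a =
     Inf (ereal ` {\<sigma>. summable (\<lambda>n. norm (a (Suc n)) * real (Suc n) powr (- \<sigma>))})"

end

theory Submission
  imports Defs
begin

text \<open>
  Fix \<open>0 \<le> \<beta> \<le> 1\<close> and multiply the \<open>L\<close>-series of the non-principal character \<open>\<chi>\<close> modulo 4 by
  one extra Euler factor at the prime 2, where \<open>\<chi>\<close> vanishes:
  \<open>f(s) = L(s, \<chi>) / (1 - 2\<^sup>\<beta> 2\<^sup>-\<^sup>s)\<close>. The coefficients stay completely multiplicative. The \<open>L\<close>-series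
  converges for \<open>\<sigma> > 0\<close> and converges absolutely exactly for \<open>\<sigma> > 1\<close>, while the geometric factor
  converges (absolutely) exactly for \<open>\<sigma> > \<beta>\<close>. The new factor is therefore the only obstruction to
  convergence to the right of 0 and does not matter for absolute convergence, so the abscissas
  are \<open>\<beta>\<close> and 1. The choice \<open>\<beta> = 1 - \<alpha>\<close> gives the theorem.

  Convergence of the product is read off from a functional equation for partial sums. If
  \<open>b (2 * n) = r * b n\<close>, then splitting by parity gives \<open>T N = S N + r * T (N div 2)\<close>, where \<open>T\<close>
  are the partial sums of \<open>b\<close> and \<open>S\<close> those over odd indices; for \<open>0 \<le> r < 1\<close> convergence of \<open>S\<close>
  forces convergence of \<open>T\<close> (\<open>summable_of_summable_odd\<close>). This applies to \<open>b n = a n * n\<^sup>-\<^sup>\<sigma>\<close> and to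
  its absolute value alike, with \<open>r = 2\<^sup>\<beta>\<^sup>-\<^sup>\<sigma>\<close>. Divergence is visible on subsequences: the terms at
  powers of 2 do not tend to 0 for \<open>\<sigma> \<le> \<beta>\<close>, and the odd terms dominate a harmonic series in absolute
  value for \<open>\<sigma> \<le> 1\<close>.
\<close>

section \<open>Series with a doubling rule\<close>

text \<open>
  The recursion halves its argument and multiplies by \<open>r < 1\<close>, so any bound on \<open>U\<close> that holds from
  some point on improves by a factor \<open>r\<close>, up to an error controlled by \<open>e\<close>.
\<close>

lemma tendsto_0_of_halving_recursion:
  fixes U e :: "nat \<Rightarrow> real"
  assumes rec: "\<And>N. U N = e N + r * U (N div 2)"
    and r: "0 \<le> r" "r < 1" and e: "e \<longlonglongrightarrow> 0"
  shows "U \<longlonglongrightarrow> 0"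
proof -
  have step: "\<bar>U N\<bar> \<le> \<bar>e N\<bar> + r * \<bar>U (N div 2)\<bar>" for N
    using abs_triangle_ineq[of "e N" "r * U (N div 2)"] r by (simp add: rec[of N, symmetric] abs_mult)
  have "Bseq e"
    using e convergent_imp_Bseq convergentI by blast
  then obtain E where E: "\<bar>e N\<bar> \<le> E" for N
    unfolding Bseq_def by auto
  define B where "B = E / (1 - r)"
  have B: "E + r * B = B"
    using r by (simp add: B_def field_simps)
  have bound: "\<bar>U N\<bar> \<le> B" for N
  proof (induction N rule: less_induct)
    case (less N)
    show ?case
    proof (cases "N = 0")
      case True
      have "(1 - r) * \<bar>U 0\<bar> \<le> E"
        using step[of 0] E[of 0] by (simp add: algebra_simps)
      then show ?thesis
        using True r by (simp add: B_def field_simps)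
    next
      case False
      then have "\<bar>U (N div 2)\<bar> \<le> B"
        by (intro less.IH) simp
      then have "r * \<bar>U (N div 2)\<bar> \<le> r * B"
        using r(1) by (rule mult_left_mono)
      then show ?thesis
        using step[of N] E[of N] B by linarith
    qed
  qed
  have iter: "\<forall>\<^sub>F N in sequentially. \<bar>U N\<bar> \<le> r ^ j * B + d / (1 - r)" if "0 < d" for d j
  proof (induction j)
    case 0
    have "\<bar>U N\<bar> \<le> B + d / (1 - r)" for N
      using bound[of N] that r by (smt (verit) divide_nonneg_pos)
    then show ?case
      by simp
  next
    case (Suc j)
    have half: "filterlim (\<lambda>N::nat. N div 2) at_top sequentially"
      by (rule filterlim_at_top_div_const_nat) simp
    have small: "\<forall>\<^sub>F N in sequentially. \<bar>e N\<bar> < d"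
      using tendstoD[OF e that] by simp
    show ?case
      using eventually_compose_filterlim[OF Suc.IH half] small
    proof eventually_elim
      case (elim N)
      have "r * \<bar>U (N div 2)\<bar> \<le> r * (r ^ j * B + d / (1 - r))"
        using elim(1) r by (intro mult_left_mono) auto
      moreover have "d + r * (r ^ j * B + d / (1 - r)) = r ^ Suc j * B + d / (1 - r)"
        using r by (simp add: field_simps)
      ultimately show ?case
        using step[of N] elim(2) by linarith
    qed
  qed
  show ?thesis
  proof (rule tendstoI)
    fix \<epsilon> :: real
    assume \<epsilon>: "0 < \<epsilon>"
    \<comment> \<open>Half of \<open>\<epsilon>\<close> for the accumulated error, the other half for the decaying initial bound.\<close>
    define d where "d = \<epsilon> / 2 * (1 - r)"
    have "0 < d"
      using \<epsilon> r by (simp add: d_def)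
    moreover have "d / (1 - r) = \<epsilon> / 2"
      unfolding d_def using r by (intro nonzero_mult_div_cancel_right) simp
    ultimately have d: "0 < d" "d / (1 - r) = \<epsilon> / 2" .
    have "(\<lambda>j. r ^ j * B) \<longlonglongrightarrow> 0 * B"
      using r by (intro tendsto_intros LIMSEQ_power_zero) auto
    then have "\<forall>\<^sub>F j in sequentially. r ^ j * B < \<epsilon> / 2"
      using \<epsilon> by (intro order_tendstoD(2)[of _ "0 * B"]) auto
    then obtain j where j: "r ^ j * B < \<epsilon> / 2"
      unfolding eventually_sequentially by blast
    show "\<forall>\<^sub>F N in sequentially. dist (U N) 0 < \<epsilon>"
      using iter[OF d(1), of j] by eventually_elim (use j d(2) in auto)
  qed
qed

text \<open>
  Unlike a rearrangement by powers of 2, working with the partial sums in their natural order needs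
  no absolute convergence of the odd part, which fails for the alternating series below when
  \<open>\<sigma> \<le> 1\<close>.
\<close>

lemma summable_of_summable_odd:
  fixes b :: "nat \<Rightarrow> real"
  assumes even: "\<And>n. b (2 * n) = r * b n" and "b 0 = 0"
    and r: "0 \<le> r" "r < 1" and odd: "summable (\<lambda>k. b (2 * k + 1))"
  shows "summable b"
proof -
  define T where "T = (\<lambda>N. \<Sum>n\<le>N. b n)"
  define S where "S = (\<lambda>N. \<Sum>k<(N + 1) div 2. b (2 * k + 1))"
  define s where "s = (\<Sum>k. b (2 * k + 1))"
  define t where "t = s / (1 - r)"
  have t: "s + r * t = t"
    using r by (simp add: t_def field_simps)
  have rec: "T N = S N + r * T (N div 2)" for N
  proof (induction N)
    case 0
    then show ?case
      using \<open>b 0 = 0\<close> by (simp add: T_def S_def)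
  next
    case (Suc N)
    show ?case
    proof (cases "even N")
      case True
      then obtain k where "N = 2 * k" ..
      then show ?thesis
        using Suc by (simp add: T_def S_def)
    next
      case False
      then obtain k where "N = 2 * k + 1" ..
      then show ?thesis
        using Suc even[of "Suc k"] by (simp add: T_def S_def distrib_left)
    qed
  qed
  have "(\<lambda>m. \<Sum>k<m. b (2 * k + 1)) \<longlonglongrightarrow> s"
    using odd unfolding s_def by (rule summable_LIMSEQ)
  moreover have "filterlim (\<lambda>N. (N + 1) div 2 :: nat) at_top sequentially"
    by (rule filterlim_compose[OF filterlim_at_top_div_const_nat filterlim_add_const_nat_at_top]) simp
  ultimately have "S \<longlonglongrightarrow> s"
    unfolding S_def by (rule filterlim_compose)
  then have err: "(\<lambda>N. S N - s) \<longlonglongrightarrow> 0"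
    by (rule LIM_zero)
  have "T N - t = (S N - s) + r * (T (N div 2) - t)" for N
    using rec[of N] t by (simp only: right_diff_distrib)
  then have "(\<lambda>N. T N - t) \<longlonglongrightarrow> 0"
    using r err
    by (rule tendsto_0_of_halving_recursion[where U = "\<lambda>N. T N - t" and e = "\<lambda>N. S N - s"])
  then have "T \<longlonglongrightarrow> t"
    by (rule LIM_zero_cancel)
  then have "b sums t"
    by (simp add: T_def sums_def_le)
  then show ?thesis
    by (rule sums_summable)
qed

section \<open>The character modulo 4 with a new value at 2\<close>

text \<open>
  On odd \<open>n\<close> the value \<open>(-1) ^ (n div 2)\<close> is that of the non-principal character modulo 4, and the
  prime 2 is sent to \<open>c\<close>. The value 0 at 0 makes the doubling rule hold without exception.
\<close>

fun chi4_ext :: "real \<Rightarrow> nat \<Rightarrow> real" where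
  "chi4_ext c n = (if n = 0 then 0 else if even n then c * chi4_ext c (n div 2) else (-1) ^ (n div 2))"

declare chi4_ext.simps [simp del]

lemma chi4_ext_0: "chi4_ext c 0 = 0"
  by (simp add: chi4_ext.simps)

lemma chi4_ext_double: "chi4_ext c (2 * n) = c * chi4_ext c n"
  by (cases "n = 0") (simp_all add: chi4_ext_0 chi4_ext.simps[of c "2 * n"])

lemma chi4_ext_odd: "chi4_ext c (2 * k + 1) = (-1) ^ k"
  by (simp add: chi4_ext.simps)

lemma chi4_ext_power_2: "chi4_ext c (2 ^ k) = c ^ k"
proof (induction k)
  case 0
  then show ?case
    using chi4_ext_odd[of c 0] by simp
next
  case (Suc k)
  then show ?case
    using chi4_ext_double[of c "2 ^ k"] by simp
qed

lemma chi4_ext_mult: "chi4_ext c (m * n) = chi4_ext c m * chi4_ext c n"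
proof (induction "m + n" arbitrary: m n rule: less_induct)
  case less
  show ?case
  proof (cases "m = 0 \<or> n = 0")
    case True
    then show ?thesis
      by (auto simp: chi4_ext_0)
  next
    case pos: False
    consider i where "m = 2 * i" | j where "n = 2 * j" | i j where "m = 2 * i + 1" "n = 2 * j + 1"
      by (metis evenE oddE)
    then show ?thesis
    proof cases
      case 1
      then show ?thesis
        using less[of i n] pos chi4_ext_double[of c "i * n"] chi4_ext_double[of c i]
        by (simp add: mult.assoc)
    next
      case 2
      then show ?thesis
        using less[of m j] pos chi4_ext_double[of c "m * j"] chi4_ext_double[of c j]
        by (simp add: mult.left_commute)
    next
      case 3
      \<comment> \<open>The cross term \<open>2ij\<close> does not affect the sign, so halves of odd numbers add up modulo 2.\<close>
      then have "m * n = 2 * (2 * (i * j) + i + j) + 1"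
        by (simp add: algebra_simps)
      then have "chi4_ext c (m * n) = (-1) ^ (2 * (i * j) + i + j)"
        by (simp only: chi4_ext_odd)
      then show ?thesis
        using 3 by (simp only: chi4_ext_odd power_add power_mult) simp
    qed
  qed
qed

section \<open>Abscissas of the extended series\<close>

definition chi4_term :: "real \<Rightarrow> real \<Rightarrow> nat \<Rightarrow> real" where
  "chi4_term \<beta> \<sigma> n = chi4_ext (2 powr \<beta>) n * real n powr (- \<sigma>)"

lemma chi4_term_0: "chi4_term \<beta> \<sigma> 0 = 0"
  by (simp add: chi4_term_def)

lemma chi4_term_double: "chi4_term \<beta> \<sigma> (2 * n) = 2 powr (\<beta> - \<sigma>) * chi4_term \<beta> \<sigma> n"
proof -
  have "(2::real) powr (\<beta> - \<sigma>) = 2 powr \<beta> * 2 powr (- \<sigma>)"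
    by (simp flip: powr_add)
  then show ?thesis
    by (simp add: chi4_term_def chi4_ext_double powr_mult)
qed

lemma chi4_term_odd: "chi4_term \<beta> \<sigma> (2 * k + 1) = (-1) ^ k * real (2 * k + 1) powr (- \<sigma>)"
  by (simp only: chi4_term_def chi4_ext_odd)

lemma halving_ratio:
  assumes "\<beta> < \<sigma>"
  shows "2 powr (\<beta> - \<sigma>) < (1::real)"
  using assms powr_less_mono[of "\<beta> - \<sigma>" 0 2] by simp

text \<open>
  For \<open>\<sigma> \<le> \<beta>\<close> the terms at powers of 2 are at least 1. For \<open>\<sigma> > \<beta> \<ge> 0\<close> the odd part is an alternating
  series.
\<close>

lemma summable_chi4_term_iff:
  assumes "0 \<le> \<beta>"
  shows "summable (chi4_term \<beta> \<sigma>) \<longleftrightarrow> \<beta> < \<sigma>"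
proof
  assume "\<beta> < \<sigma>"
  then have "0 < \<sigma>"
    using assms by simp
  have "filterlim (\<lambda>k. real (2 * k + 1)) at_top sequentially"
    by (rule filterlim_compose[OF filterlim_real_sequentially filterlim_subseq])
      (simp add: strict_mono_def)
  then have "(\<lambda>k. real (2 * k + 1) powr (- \<sigma>)) \<longlonglongrightarrow> 0"
    by (rule tendsto_neg_powr[rotated]) (simp add: \<open>0 < \<sigma>\<close>)
  moreover have "monoseq (\<lambda>k. real (2 * k + 1) powr (- \<sigma>))"
    using \<open>0 < \<sigma>\<close> by (intro decseq_imp_monoseq) (simp add: decseq_def powr_mono2')
  ultimately have "summable (\<lambda>k. chi4_term \<beta> \<sigma> (2 * k + 1))"
    unfolding chi4_term_odd by (rule summable_Leibniz(1))
  then show "summable (chi4_term \<beta> \<sigma>)"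
    using summable_of_summable_odd[of "chi4_term \<beta> \<sigma>", OF chi4_term_double chi4_term_0]
      halving_ratio[OF \<open>\<beta> < \<sigma>\<close>] by simp
next
  assume "summable (chi4_term \<beta> \<sigma>)"
  then have "chi4_term \<beta> \<sigma> \<longlonglongrightarrow> 0"
    by (rule summable_LIMSEQ_zero)
  then have lim: "(\<lambda>k. chi4_term \<beta> \<sigma> (2 ^ k)) \<longlonglongrightarrow> 0"
    by (rule filterlim_compose) (rule filterlim_subseq, simp add: strict_mono_def)
  show "\<beta> < \<sigma>"
  proof (rule ccontr)
    assume "\<not> \<beta> < \<sigma>"
    have ge: "1 \<le> chi4_term \<beta> \<sigma> (2 ^ k)" for k
    proof (induction k)
      case 0
      then show ?case
        using chi4_term_odd[of \<beta> \<sigma> 0] by simp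
    next
      case (Suc k)
      have "1 \<le> (2::real) powr (\<beta> - \<sigma>)"
        using \<open>\<not> \<beta> < \<sigma>\<close> by (simp add: ge_one_powr_ge_zero)
      then show ?case
        using Suc mult_mono[of 1 "2 powr (\<beta> - \<sigma>)" 1 "chi4_term \<beta> \<sigma> (2 ^ k)"]
          chi4_term_double[of \<beta> \<sigma> "2 ^ k"] by simp
    qed
    have "(1::real) \<le> 0"
      using LIMSEQ_le_const[OF lim, of 1] ge by blast
    then show False
      by simp
  qed
qed

text \<open>
  The odd part of the series of absolute values is \<open>\<Sum> (2k+1)\<^sup>-\<^sup>\<sigma>\<close>, and \<open>\<beta> \<le> 1\<close> keeps the factor at
  2 convergent whenever that series is.
\<close>

lemma summable_abs_chi4_term_iff:
  assumes "\<beta> \<le> 1"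
  shows "summable (\<lambda>n. \<bar>chi4_term \<beta> \<sigma> n\<bar>) \<longleftrightarrow> 1 < \<sigma>"
proof -
  have inj: "inj (\<lambda>k::nat. 2 * k + 1)"
    by (auto simp: inj_def)
  show ?thesis
  proof
    assume "1 < \<sigma>"
    then have "summable (\<lambda>n. real n powr (- \<sigma>))"
      by (simp add: summable_real_powr_iff)
    then have "summable (\<lambda>k. real (2 * k + 1) powr (- \<sigma>))"
      using summable_reindex[OF _ inj, of "\<lambda>n. real n powr (- \<sigma>)"] by (simp add: o_def)
    then have "summable (\<lambda>k. \<bar>chi4_term \<beta> \<sigma> (2 * k + 1)\<bar>)"
      unfolding chi4_term_odd by (simp add: abs_mult power_abs)
    then show "summable (\<lambda>n. \<bar>chi4_term \<beta> \<sigma> n\<bar>)"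
      using summable_of_summable_odd[of "\<lambda>n. \<bar>chi4_term \<beta> \<sigma> n\<bar>" "2 powr (\<beta> - \<sigma>)"]
        assms \<open>1 < \<sigma>\<close> halving_ratio[of \<beta> \<sigma>]
      by (simp add: chi4_term_double chi4_term_0 abs_mult)
  next
    assume sum: "summable (\<lambda>n. \<bar>chi4_term \<beta> \<sigma> n\<bar>)"
    show "1 < \<sigma>"
    proof (rule ccontr)
      assume "\<not> 1 < \<sigma>"
      have odd: "summable (\<lambda>k. \<bar>chi4_term \<beta> \<sigma> (2 * k + 1)\<bar>)"
        using summable_reindex[OF sum inj] by (simp add: o_def)
      have "1 / real (Suc k) \<le> 2 * \<bar>chi4_term \<beta> \<sigma> (2 * k + 1)\<bar>" for k
      proof -
        have "real (2 * k + 1) powr (- 1) \<le> real (2 * k + 1) powr (- \<sigma>)"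
          using \<open>\<not> 1 < \<sigma>\<close> by (intro powr_mono) auto
        moreover have "1 / real (Suc k) \<le> 2 * real (2 * k + 1) powr (- 1)"
          by (simp add: powr_minus_divide field_simps)
        ultimately show ?thesis
          unfolding chi4_term_odd by (simp add: abs_mult power_abs)
      qed
      then have "summable (\<lambda>k. 1 / real (Suc k))"
        by (intro summable_comparison_test'[OF summable_mult[OF odd, of 2]]) simp
      then have "summable (\<lambda>n. 1 / real n)"
        by (subst (asm) summable_Suc_iff[of "\<lambda>n. 1 / real n"])
      then show False
        using not_summable_harmonic[where 'a = real] by (simp add: inverse_eq_divide)
    qed
  qed
qed

lemma Inf_ereal_greaterThan: "Inf (ereal ` {x<..}) = ereal x"
proof (rule antisym)
  show "Inf (ereal ` {x<..}) \<le> ereal x"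
  proof (rule dense_ge)
    fix z
    assume "ereal x < z"
    then obtain y where "ereal x < ereal y" "ereal y < z"
      using ereal_dense2 by blast
    then show "Inf (ereal ` {x<..}) \<le> z"
      by (intro Inf_lower2[of "ereal y"]) auto
  qed
qed (auto intro!: Inf_greatest)

theorem theorem1:
  fixes \<alpha> :: real
  assumes "\<alpha> \<in> {0..1}"
  shows "\<exists>a :: nat \<Rightarrow> complex. completely_multiplicative a \<and>
           \<bar>abscissa_abs_conv a\<bar> \<noteq> \<infinity> \<and> \<bar>abscissa_conv a\<bar> \<noteq> \<infinity> \<and>
           abscissa_abs_conv a - abscissa_conv a = ereal \<alpha>"
proof -
  define \<beta> where "\<beta> = 1 - \<alpha>"
  have \<beta>: "0 \<le> \<beta>" "\<beta> \<le> 1"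
    using assms by (auto simp: \<beta>_def)
  define a where "a n = complex_of_real (chi4_ext (2 powr \<beta>) n)" for n
  have "completely_multiplicative a"
    by (simp add: completely_multiplicative_def a_def chi4_ext_mult)
  moreover have "abscissa_conv a = ereal \<beta>"
  proof -
    have "a (Suc n) * of_nat (Suc n) powr (- complex_of_real \<sigma>) = complex_of_real (chi4_term \<beta> \<sigma> (Suc n))" for n \<sigma>
      using powr_of_real[of "real (Suc n)" "- \<sigma>"] by (simp add: a_def chi4_term_def)
    then have "summable (\<lambda>n. a (Suc n) * of_nat (Suc n) powr (- complex_of_real \<sigma>)) \<longleftrightarrow> \<beta> < \<sigma>" for \<sigma>
      using summable_chi4_term_iff[OF \<beta>(1)]
      by (simp only: summable_of_real_iff summable_Suc_iff[of "chi4_term \<beta> \<sigma>"])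
    then show ?thesis
      unfolding abscissa_conv_def using Inf_ereal_greaterThan[of \<beta>] by (simp add: greaterThan_def)
  qed
  moreover have "abscissa_abs_conv a = ereal 1"
  proof -
    have "norm (a (Suc n)) * real (Suc n) powr (- \<sigma>) = \<bar>chi4_term \<beta> \<sigma> (Suc n)\<bar>" for n \<sigma>
      by (simp add: a_def chi4_term_def abs_mult)
    then have "summable (\<lambda>n. norm (a (Suc n)) * real (Suc n) powr (- \<sigma>)) \<longleftrightarrow> 1 < \<sigma>" for \<sigma>
      using summable_abs_chi4_term_iff[OF \<beta>(2)]
      by (simp only: summable_Suc_iff[of "\<lambda>n. \<bar>chi4_term \<beta> \<sigma> n\<bar>"])
    then show ?thesis
      unfolding abscissa_abs_conv_def using Inf_ereal_greaterThan[of 1] by (simp add: greaterThan_def)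
  qed
  ultimately show ?thesis
    by (intro exI[of _ a]) (simp add: \<beta>_def one_ereal_def)
qed

end
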